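(* Let $n\ge1$. There is a coupling $(W_n,U_n)$, i.e. a probability distribution on $\mathcal{W}_n\times\mathcal{U}_n$ whose marginals are the uniform distribution on $\mathcal W_n$ (law of $W_n$) and the uniform distribution on $\mathcal U_n$ (law of $U_n$), such that, with probability one, for all $k$, \[ \widehat\Lambda_{k-2}^{(n)}\;\leq\;\widehat\lambda_k^{(n)}\;\leq\;\widehat\Lambda_{k+2}^{(n)}, \] and in particular \[ |\mu_n-(M_n-m_n)|\leq3 . \]
   Context: A plane tree is a rooted tree in which the children of each vertex are linearly ordered. An embedded tree is a plane tree whose vertices carry integer labels such that the labels of adjacent vertices differ by at most $1$ and the root vertex has label $1$. $\mathcal U_n$ is the set of embedded trees with $n$ edges, and $\mathcal W_n\subset\mathcal U_n$ is the subset of well labelled trees, i.e. those all of whose labels are positive. For a labelled tree $T$ let $\lambda_k^{[T]}$ be its number of vertices with label $k$. For the random trees: $\widehat\lambda^{(n)}_k=\sum_{\ell=1}^k\lambda_\ell^{[W_n]}$; $m_n$ and $M_n$ are the minimal and maximal labels of $U_n$; $\widehat\Lambda_k^{(n)}=\sum_{\ell=1}^k\lambda^{[U_n]}_{m_n+\ell-1}$; $\mu_n$ is the maximal label of $W_n$. Empty sums are $0$. *)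

theory Defs
  imports "HOL-Probability.Probability"
begin

text \<open>Plane trees with decorated vertices; the root subtrees come in linear order.
  The generated \<open>set_ptree\<close> yields the set of labels occurring in a tree.\<close>

datatype 'a ptree = Node (root_label: 'a) (children: "'a ptree list")

primrec edges :: "'a ptree \<Rightarrow> nat" where
  "edges (Node a ts) = sum_list (map (\<lambda>t. Suc (edges t)) ts)"

primrec label_count :: "'a ptree \<Rightarrow> 'a \<Rightarrow> nat" where
  "label_count (Node a ts) k = (if a = k then 1 else 0) + sum_list (map (\<lambda>t. label_count t k) ts)"

fun small_steps :: "int ptree \<Rightarrow> bool" where
  "small_steps (Node a ts) \<longleftrightarrow> (\<forall>t\<in>set ts. \<bar>root_label t - a\<bar> \<le> 1 \<and> small_steps t)"

definition embedded_trees :: "nat \<Rightarrow> int ptree set" where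
  "embedded_trees n = {t. edges t = n \<and> root_label t = 1 \<and> small_steps t}"

definition well_labelled_trees :: "nat \<Rightarrow> int ptree set" where
  "well_labelled_trees n = {t \<in> embedded_trees n. \<forall>x\<in>set_ptree t. x > 0}"

definition min_label :: "int ptree \<Rightarrow> int" where
  "min_label t = Min (set_ptree t)"

definition max_label :: "int ptree \<Rightarrow> int" where
  "max_label t = Max (set_ptree t)"

text \<open>The index \<open>k\<close> is an integer, so that \<open>k - 2\<close> is not truncated; sums are empty for \<open>k < 1\<close>.\<close>

definition cumul :: "int ptree \<Rightarrow> int \<Rightarrow> nat" where
  "cumul t k = (\<Sum>l = 1..k. label_count t l)"

definition shifted_cumul :: "int ptree \<Rightarrow> int \<Rightarrow> nat" where
  "shifted_cumul t k = (\<Sum>l = 1..k. label_count t (min_label t + l - 1))"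

text \<open>Finiteness and nonemptiness ensure that \<open>pmf_of_set\<close> of the two classes of trees
  is the uniform distribution, and that \<open>min_label\<close> and \<open>max_label\<close> are meaningful.\<close>

lemma finite_set_ptree [simp]: "finite (set_ptree t)"
  by (induction t) auto

lemma set_ptree_nonempty [simp]: "set_ptree t \<noteq> {}"
  by (cases t) auto

lemma length_le_edges: "length ts \<le> edges (Node a ts)"
  by (induction ts) auto

lemma edges_child: "t \<in> set ts \<Longrightarrow> edges t < edges (Node a ts)"
  by (induction ts) auto

lemma finite_small_steps:
  "finite {t. edges t \<le> n \<and> root_label t = a \<and> small_steps t}"
proof (induction n arbitrary: a)
  case 0
  have "{t. edges t \<le> 0 \<and> root_label t = a \<and> small_steps t} \<subseteq> {Node a []}"
  proof
    fix t assume t: "t \<in> {t. edges t \<le> 0 \<and> root_label t = a \<and> small_steps t}"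
    obtain b ts where "t = Node b ts" by (cases t)
    with t length_le_edges[of ts b] show "t \<in> {Node a []}" by simp
  qed
  then show ?case by (rule finite_subset) simp
next
  case (Suc n)
  let ?A = "\<Union>b\<in>{a - 1..a + 1}. {t. edges t \<le> n \<and> root_label t = b \<and> small_steps t}"
  have fin: "finite ?A" using Suc.IH by blast
  have "{t. edges t \<le> Suc n \<and> root_label t = a \<and> small_steps t}
    \<subseteq> Node a ` {ts. set ts \<subseteq> ?A \<and> length ts \<le> Suc n}"
  proof
    fix t assume t: "t \<in> {t. edges t \<le> Suc n \<and> root_label t = a \<and> small_steps t}"
    obtain b ts where tb: "t = Node b ts" by (cases t)
    have "s \<in> ?A" if s: "s \<in> set ts" for s
    proof -
      have "\<bar>root_label s - a\<bar> \<le> 1" "small_steps s" "edges s < edges t"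
        using t s tb edges_child[OF s] by auto
      then show ?thesis using t by auto
    qed
    moreover have "length ts \<le> Suc n"
      using length_le_edges[of ts b] t tb by simp
    ultimately show "t \<in> Node a ` {ts. set ts \<subseteq> ?A \<and> length ts \<le> Suc n}"
      using t tb by auto
  qed
  then show ?case
    by (rule finite_subset) (intro finite_imageI finite_lists_length_le fin)
qed

lemma finite_embedded_trees: "finite (embedded_trees n)"
  by (rule finite_subset[OF _ finite_small_steps[of n 1]]) (auto simp: embedded_trees_def)

lemma well_labelled_subset_embedded: "well_labelled_trees n \<subseteq> embedded_trees n"
  by (auto simp: well_labelled_trees_def)

lemma finite_well_labelled_trees: "finite (well_labelled_trees n)"
  using finite_subset[OF well_labelled_subset_embedded finite_embedded_trees] .

lemma well_labelled_trees_nonempty: "well_labelled_trees n \<noteq> {}"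
proof -
  have "Node 1 (replicate n (Node 1 [])) \<in> well_labelled_trees n"
    by (auto simp: well_labelled_trees_def embedded_trees_def sum_list_replicate)
  then show ?thesis by blast
qed

lemma embedded_trees_nonempty: "embedded_trees n \<noteq> {}"
  using well_labelled_trees_nonempty well_labelled_subset_embedded by blast

end

theory Submission
  imports Defs
begin

text \<open>Embedded trees correspond to binary trees with one bud at each inner node. Walk
  around such a blossom tree, going up at each leaf and down at each bud, the root itself counting
  as a leaf: the labels of the embedded tree are the heights at which the \<open>n + 1\<close> leaves other
  than the root are met, and one full turn has \<open>n + 2\<close> up steps and \<open>n\<close> down steps. Moving the
  root to another leaf is a cyclic shift of the walk, so by the cycle lemma exactly two of the
  \<open>n + 2\<close> shifts keep all heights positive. The coupling pairs a uniform embedded tree with one of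
  its two well labelled shifts, and a cyclic shift alters the heights by at most 2 up to a constant,
  apart from exchanging one leaf.\<close>

section \<open>Blossom trees\<close>

text \<open>The constructors tell whether the bud precedes, separates or follows the two subtrees.\<close>

datatype blossom =
    Leaf
  | Bud_First blossom blossom
  | Bud_Middle blossom blossom
  | Bud_Last blossom blossom

fun inner_nodes :: "blossom \<Rightarrow> nat" where
  "inner_nodes Leaf = 0"
| "inner_nodes (Bud_First l r) = Suc (inner_nodes l + inner_nodes r)"
| "inner_nodes (Bud_Middle l r) = Suc (inner_nodes l + inner_nodes r)"
| "inner_nodes (Bud_Last l r) = Suc (inner_nodes l + inner_nodes r)"

text \<open>Going round a subtree raises the height by 1, since it has one more leaf than buds.\<close>

fun leaf_heights :: "int \<Rightarrow> blossom \<Rightarrow> int list" where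
  "leaf_heights h Leaf = [h]"
| "leaf_heights h (Bud_First l r) = leaf_heights (h - 1) l @ leaf_heights h r"
| "leaf_heights h (Bud_Middle l r) = leaf_heights h l @ leaf_heights h r"
| "leaf_heights h (Bud_Last l r) = leaf_heights h l @ leaf_heights (h + 1) r"

lemma length_leaf_heights: "length (leaf_heights h b) = Suc (inner_nodes b)"
  by (induction h b rule: leaf_heights.induct) auto

lemma leaf_heights_nonempty [simp]: "leaf_heights h b \<noteq> []"
  by (induction h b rule: leaf_heights.induct) auto

lemma leaf_heights_shift: "leaf_heights (h + d) b = map (\<lambda>x. x + d) (leaf_heights h b)"
proof (induction h b rule: leaf_heights.induct)
  case (2 h l r)
  then show ?case by (simp add: algebra_simps)
next
  case (4 h l r)
  then show ?case by (simp add: algebra_simps)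
qed auto

text \<open>The bounds on the first and last leaf carry the induction: the right subtree is entered
  at most 1 above the left one, whose last leaf is at least as high as its entry.\<close>

lemma leaf_heights_steps:
  "successively (\<lambda>x y. y \<le> x + 1) (leaf_heights h b) \<and>
    hd (leaf_heights h b) \<le> h \<and> h \<le> last (leaf_heights h b)"
  by (induction h b rule: leaf_heights.induct) (auto simp: successively_append_iff)

text \<open>In the last case it is the right subtree that is entered at height \<open>h + 1\<close>, so the
  roles of first child and remaining siblings are exchanged.\<close>

fun to_ptree :: "int \<Rightarrow> blossom \<Rightarrow> int ptree" where
  "to_ptree h Leaf = Node h []"
| "to_ptree h (Bud_First l r) = Node h (to_ptree (h - 1) l # children (to_ptree h r))"
| "to_ptree h (Bud_Middle l r) = Node h (to_ptree h l # children (to_ptree h r))"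
| "to_ptree h (Bud_Last l r) = Node h (to_ptree (h + 1) r # children (to_ptree h l))"

lemma root_label_to_ptree [simp]: "root_label (to_ptree h b) = h"
  by (cases b) auto

lemma Node_children_to_ptree [simp]: "Node h (children (to_ptree h b)) = to_ptree h b"
  by (metis ptree.collapse root_label_to_ptree)

lemma children_to_ptree_eq_iff:
  "children (to_ptree h b) = children (to_ptree h c) \<longleftrightarrow> to_ptree h b = to_ptree h c"
  by (metis Node_children_to_ptree)

text \<open>\<open>to_ptree\<close> splits off the first child and leaves a tree with the same root;
  this rule and the next three follow that decomposition.\<close>

lemma edges_Node_Cons: "edges (Node a (t # ts)) = Suc (edges t + edges (Node a ts))"
  by simp

lemma label_count_Node_Cons:
  "label_count (Node a (t # ts)) k = label_count t k + label_count (Node a ts) k"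
  by simp

lemma small_steps_Node_Cons:
  "small_steps (Node a (t # ts)) \<longleftrightarrow>
    \<bar>root_label t - a\<bar> \<le> 1 \<and> small_steps t \<and> small_steps (Node a ts)"
  by auto

lemma set_ptree_Node_Cons: "set_ptree (Node a (t # ts)) = set_ptree t \<union> set_ptree (Node a ts)"
  by auto

lemma edges_to_ptree: "edges (to_ptree h b) = inner_nodes b"
proof (induction h b rule: to_ptree.induct)
  case 1
  then show ?case by simp
qed (simp_all add: edges_Node_Cons del: edges.simps)

lemma label_count_to_ptree: "label_count (to_ptree h b) k = count_list (leaf_heights h b) k"
proof (induction h b rule: to_ptree.induct)
  case 1
  then show ?case by simp
qed (simp_all add: label_count_Node_Cons del: label_count.simps)

lemma small_steps_to_ptree: "small_steps (to_ptree h b)"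
proof (induction h b rule: to_ptree.induct)
  case 1
  then show ?case by simp
qed (simp_all add: small_steps_Node_Cons del: small_steps.simps)

lemma set_ptree_to_ptree: "set_ptree (to_ptree h b) = set (leaf_heights h b)"
proof (induction h b rule: to_ptree.induct)
  case 1
  then show ?case by simp
qed (auto simp: set_ptree_Node_Cons simp del: ptree.set)

lemma to_ptree_inj: "to_ptree h b = to_ptree h c \<Longrightarrow> b = c"
proof (induction h b arbitrary: c rule: to_ptree.induct)
  case (1 h)
  then show ?case by (cases c) auto
next
  case (2 h l r)
  then show ?case
    by (cases c) (auto dest: arg_cong[where f = root_label] simp: children_to_ptree_eq_iff)
next
  case (3 h l r)
  then show ?case
    by (cases c) (auto dest: arg_cong[where f = root_label] simp: children_to_ptree_eq_iff)
next
  case (4 h l r)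
  then show ?case
    by (cases c) (auto dest: arg_cong[where f = root_label] simp: children_to_ptree_eq_iff)
qed

lemma to_ptree_surj: "small_steps t \<Longrightarrow> \<exists>b. to_ptree (root_label t) b = t"
proof (induction "edges t" arbitrary: t rule: less_induct)
  case less
  obtain h us where t: "t = Node h us" by (cases t)
  show ?case
  proof (cases us)
    case Nil
    then have "to_ptree (root_label t) Leaf = t" using t by simp
    then show ?thesis ..
  next
    case (Cons s ts)
    have lt: "edges s < edges t" "edges (Node h ts) < edges t"
      unfolding t Cons by simp_all
    have steps: "\<bar>root_label s - h\<bar> \<le> 1" "small_steps s" "small_steps (Node h ts)"
      using less.prems unfolding t Cons by auto
    obtain c d where c: "to_ptree (root_label s) c = s" and d: "to_ptree h d = Node h ts"
      using less.hyps[OF lt(1) steps(2)] less.hyps[OF lt(2) steps(3)] by auto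
    from steps(1) consider "root_label s = h - 1" | "root_label s = h" | "root_label s = h + 1"
      by linarith
    then show ?thesis
    proof cases
      case 1
      then have "to_ptree (root_label t) (Bud_First c d) = t" using c d t Cons by simp
      then show ?thesis ..
    next
      case 2
      then have "to_ptree (root_label t) (Bud_Middle c d) = t" using c d t Cons by simp
      then show ?thesis ..
    next
      case 3
      then have "to_ptree (root_label t) (Bud_Last d c) = t" using c d t Cons by simp
      then show ?thesis ..
    qed
  qed
qed

lemma bij_betw_to_ptree: "bij_betw (to_ptree 1) {b. inner_nodes b = n} (embedded_trees n)"
proof (rule bij_betwI')
  fix t assume t: "t \<in> embedded_trees n"
  then obtain b where "to_ptree 1 b = t"
    using to_ptree_surj[of t] by (auto simp: embedded_trees_def)
  then show "\<exists>b\<in>{b. inner_nodes b = n}. t = to_ptree 1 b"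
    using t edges_to_ptree[of 1 b] by (auto simp: embedded_trees_def)
qed (auto simp: embedded_trees_def edges_to_ptree small_steps_to_ptree dest: to_ptree_inj)

text \<open>\<open>reroot b c\<close> hangs \<open>b\<close> by its leftmost leaf, with \<open>c\<close> grafted at the former root.\<close>

fun reroot :: "blossom \<Rightarrow> blossom \<Rightarrow> blossom" where
  "reroot Leaf c = c"
| "reroot (Bud_First l r) c = reroot l (Bud_Last r c)"
| "reroot (Bud_Middle l r) c = reroot l (Bud_First r c)"
| "reroot (Bud_Last l r) c = reroot l (Bud_Middle r c)"

text \<open>Undoes \<open>reroot\<close> step by step, following right subtrees back to the former
  root. Both read the cyclic order at a node from another neighbour: parent, bud, \<open>l\<close>,
  \<open>r\<close> becomes \<open>r\<close>, parent, bud when read from \<open>l\<close>.\<close>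

fun unroot :: "blossom \<Rightarrow> blossom \<Rightarrow> blossom" where
  "unroot Leaf c = c"
| "unroot (Bud_Last l r) c = unroot r (Bud_First c l)"
| "unroot (Bud_First l r) c = unroot r (Bud_Middle c l)"
| "unroot (Bud_Middle l r) c = unroot r (Bud_Last c l)"

definition rotate_root :: "blossom \<Rightarrow> blossom" where
  "rotate_root b = reroot b Leaf"

lemma unroot_reroot: "unroot (reroot b c) Leaf = unroot c b"
  by (induction b c rule: reroot.induct) auto

lemma inj_rotate_root: "inj rotate_root"
  by (rule inj_on_inverseI[where g = "\<lambda>b. unroot b Leaf"])
    (simp add: rotate_root_def unroot_reroot)

lemma inner_nodes_reroot: "inner_nodes (reroot b c) = inner_nodes b + inner_nodes c"
  by (induction b c rule: reroot.induct) auto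

lemma inner_nodes_rotate_root_pow: "inner_nodes ((rotate_root ^^ i) b) = inner_nodes b"
  by (induction i) (auto simp: rotate_root_def inner_nodes_reroot)

text \<open>The leftmost leaf becomes the root, so the new walk starts one above its height and
  meets the other leaves of \<open>b\<close> unchanged. It enters \<open>c\<close> at
  \<open>h + 1\<close>, since going round \<open>b\<close> raises the height by 1.\<close>

lemma leaf_heights_reroot:
  "leaf_heights (hd (leaf_heights h b) + 1) (reroot b c) =
    tl (leaf_heights h b) @ leaf_heights (h + 1) c"
  by (induction b c arbitrary: h rule: reroot.induct) (auto simp: add.commute)

text \<open>Subtracting \<open>x\<close> puts the new root at height 0; the entry \<open>2\<close>
  is the old root, met again after a full turn.\<close>

lemma leaf_heights_rotate_root:
  assumes "leaf_heights 1 b = x # xs"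
  shows "leaf_heights 1 (rotate_root b) = map (\<lambda>y. y - x) (xs @ [2])"
proof -
  have "leaf_heights (1 + x) (rotate_root b) = xs @ [2]"
    using leaf_heights_reroot[of 1 b Leaf] assms by (simp add: rotate_root_def add.commute)
  then have "map (\<lambda>y. y + x) (leaf_heights 1 (rotate_root b)) = xs @ [2]"
    by (simp add: leaf_heights_shift)
  from arg_cong[OF this, of "map (\<lambda>y. y - x)"] show ?thesis
    by (simp add: comp_def)
qed

text \<open>The height at which the \<open>j\<close>-th leaf is met on an endless walk that starts at the root.\<close>

definition walk :: "blossom \<Rightarrow> nat \<Rightarrow> int" where
  "walk b j = (0 # leaf_heights 1 b) ! (j mod (inner_nodes b + 2))
    + 2 * int (j div (inner_nodes b + 2))"

lemma walk_period: "walk b (j + (inner_nodes b + 2)) = walk b j + 2"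
  unfolding walk_def mod_add_self2 by (subst div_add_self2) simp_all

text \<open>Leaving a leaf raises the height by 1, and only buds lie between it and the next
  leaf.\<close>

lemma walk_step: "walk b (Suc j) \<le> walk b j + 1"
proof -
  let ?N = "inner_nodes b + 2" and ?H = "0 # leaf_heights 1 b"
  have len: "length ?H = ?N" by (simp add: length_leaf_heights)
  have succ: "successively (\<lambda>x y. y \<le> x + 1) ?H"
    using leaf_heights_steps[of 1 b] by (simp add: successively_Cons)
  show ?thesis
  proof (cases "Suc (j mod ?N) = ?N")
    \<comment> \<open>The next leaf is the root again, 2 above its height at the start of this turn,
      while the last leaf is at least 1 above that height.\<close>
    case True
    then have "?H ! (j mod ?N) = last ?H"
      using len by (simp add: last_conv_nth length_leaf_heights)
    moreover have "last ?H \<ge> 1" using leaf_heights_steps[of 1 b] by simp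
    moreover have mod: "Suc j mod ?N = 0" using True by (metis mod_Suc)
    moreover have "Suc j div ?N = Suc (j div ?N)" using mod by (metis div_Suc)
    ultimately show ?thesis unfolding walk_def by simp
  next
    case False
    then have less: "Suc (j mod ?N) < ?N"
      using mod_less_divisor[of ?N j] by linarith
    have "?H ! Suc (j mod ?N) \<le> ?H ! (j mod ?N) + 1"
      using succ less unfolding successively_conv_nth len by blast
    moreover have mod: "Suc j mod ?N = Suc (j mod ?N)" using False by (metis mod_Suc)
    moreover have "Suc j div ?N = j div ?N" using mod by (metis div_Suc nat.distinct(1))
    ultimately show ?thesis unfolding walk_def by (simp only:)
  qed
qed

lemma leaf_heights_rotate_root_pow:
  "leaf_heights 1 ((rotate_root ^^ i) b) =
    map (\<lambda>d. walk b (i + d) - walk b i) [1..<inner_nodes b + 2]"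
proof (induction i)
  case 0
  show ?case
  proof (rule nth_equalityI)
    fix j assume "j < length (leaf_heights 1 ((rotate_root ^^ 0) b))"
    then show "leaf_heights 1 ((rotate_root ^^ 0) b) ! j =
        map (\<lambda>d. walk b (0 + d) - walk b 0) [1..<inner_nodes b + 2] ! j"
      by (simp add: length_leaf_heights walk_def del: upt_Suc)
  qed (simp add: length_leaf_heights)
next
  case (Suc i)
  let ?N = "inner_nodes b + 2"
  have "[1..<?N] = 1 # [2..<?N]"
    by (subst upt_conv_Cons) (simp_all add: numeral_2_eq_2 del: upt_Suc)
  then have "leaf_heights 1 ((rotate_root ^^ i) b) =
      (walk b (Suc i) - walk b i) # map (\<lambda>d. walk b (i + d) - walk b i) [2..<?N]"
    using Suc.IH by simp
  \<comment> \<open>The first leaf drops out as the new root; the appended \<open>2\<close>,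
    measured from \<open>walk b i\<close>, is \<open>walk b (i + ?N)\<close>.\<close>
  from leaf_heights_rotate_root[OF this]
  have "leaf_heights 1 ((rotate_root ^^ Suc i) b) =
      map (\<lambda>d. walk b (i + d) - walk b (Suc i)) [2..<?N] @
      [walk b (i + ?N) - walk b (Suc i)]"
    by (simp add: comp_def walk_period[of b i, simplified])
  also have "\<dots> = map (\<lambda>d. walk b (i + d) - walk b (Suc i)) [2..<Suc ?N]"
    by simp
  also have "\<dots> = map (\<lambda>d. walk b (Suc i + d) - walk b (Suc i)) [1..<?N]"
    by (rule nth_equalityI) (simp_all del: upt_Suc)
  finally show ?case .
qed

section \<open>The cycle lemma\<close>

locale drifting_walk =
  fixes X :: "nat \<Rightarrow> int" and N :: nat
  assumes N_ge_2: "2 \<le> N"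
    and period: "X (j + N) = X j + 2"
    and step: "X (Suc j) \<le> X j + 1"
begin

definition positive_from :: "nat \<Rightarrow> bool" where
  "positive_from j \<longleftrightarrow> (\<forall>d\<in>{1..<N}. X j < X (j + d))"

definition window_min :: "nat \<Rightarrow> int" where
  "window_min j = Min (X ` {j..<j + N})"

text \<open>The minima over windows of length \<open>N\<close> increase exactly at the starts of positive
  excursions, and by 2 over a whole period.\<close>

lemma window_min_Suc: "window_min (Suc j) = window_min j + of_bool (positive_from j)"
proof -
  define M where "M = Min (X ` {Suc j..<j + N})"
  have ne: "X ` {Suc j..<j + N} \<noteq> {}" using N_ge_2 by auto
  have "{j..<j + N} = insert j {Suc j..<j + N}" using N_ge_2 by auto
  then have 1: "window_min j = min (X j) M"
    unfolding window_min_def M_def using ne by simp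
  have "{Suc j..<Suc j + N} = insert (j + N) {Suc j..<j + N}" using N_ge_2 by auto
  then have 2: "window_min (Suc j) = min (X j + 2) M"
    unfolding window_min_def M_def using ne by (simp add: period)
  \<comment> \<open>Since \<open>M\<close> is at most \<open>X j + 1\<close>, the incoming value
    \<open>X j + 2\<close> never matters. The minimum changes only if \<open>X j < M\<close>, and
    then \<open>M = X j + 1\<close>.\<close>
  have "M \<le> X (Suc j)" unfolding M_def using N_ge_2 by (intro Min_le) auto
  then have le: "M \<le> X j + 1" using step[of j] by linarith
  have "positive_from j \<longleftrightarrow> (\<forall>i\<in>{Suc j..<j + N}. X j < X i)"
  proof
    assume pos: "positive_from j"
    show "\<forall>i\<in>{Suc j..<j + N}. X j < X i"
    proof
      fix i assume "i \<in> {Suc j..<j + N}"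
      then have "i - j \<in> {1..<N}" "i = j + (i - j)" by auto
      then show "X j < X i" using pos unfolding positive_from_def by metis
    qed
  qed (auto simp: positive_from_def)
  also have "\<dots> \<longleftrightarrow> X j < M" unfolding M_def using ne by (simp add: Min_gr_iff)
  finally show ?thesis using 1 2 le by auto
qed

lemma card_positive_from: "card {j. j < N \<and> positive_from j} = 2"
proof -
  have "int (card {j. j < N \<and> positive_from j}) = (\<Sum>j<N. of_bool (positive_from j))"
    by (simp add: of_bool_def sum.If_cases Int_def lessThan_def)
  also have "\<dots> = (\<Sum>j<N. window_min (Suc j) - window_min j)"
    by (simp add: window_min_Suc)
  also have "\<dots> = window_min N - window_min 0"
    by (rule sum_lessThan_telescope)
  also have "X ` {N..<N + N} = (\<lambda>x. x + 2) ` X ` {0..<N}"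
  proof -
    have "{N..<N + N} = (\<lambda>j. j + N) ` {0..<N}" by (simp add: image_add_atLeastLessThan')
    then show ?thesis by (simp only: image_image period)
  qed
  then have "window_min N = window_min 0 + 2"
    unfolding window_min_def using N_ge_2 by (simp add: Min_add_commute image_image)
  finally show ?thesis by simp
qed

text \<open>A discrete intermediate value theorem: with upward steps of at most 1, no height on the
  way up is skipped.\<close>

lemma ex_height_eq:
  assumes "X (i + d) \<ge> x" "X i \<le> x"
  shows "\<exists>e\<le>d. X (i + e) = x"
  using assms
proof (induction d)
  case (Suc d)
  show ?case
  proof (cases "X (i + d) \<ge> x")
    case True
    then show ?thesis using Suc by (meson le_Suc_eq)
  next
    case False
    then have "X (i + Suc d) = x" using Suc.prems(1) step[of "i + d"] by simp
    then show ?thesis by blast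
  qed
qed auto

lemma ex_positive_height_eq:
  assumes "d \<in> {1..<N}" "1 \<le> k" "k \<le> X (j + d) - X j"
  shows "\<exists>e\<in>{1..<N}. X (j + e) - X j = k"
proof -
  have "X (Suc j + (d - 1)) \<ge> X j + k" "X (Suc j) \<le> X j + k"
    using assms step[of j] by auto
  then obtain e where "e \<le> d - 1" "X (Suc j + e) = X j + k"
    using ex_height_eq by blast
  then have "Suc e \<in> {1..<N}" "X (j + Suc e) - X j = k" using assms(1) by auto
  then show ?thesis by blast
qed

text \<open>Index \<open>i\<close> is left out because it stands for the root leaf, which gives no
  vertex of the embedded tree.\<close>

definition count_below :: "nat \<Rightarrow> int \<Rightarrow> nat" where
  "count_below i x = card {d\<in>{i<..<i + N}. X d \<le> x}"

lemma positive_from_less: "positive_from j \<Longrightarrow> d \<in> {j<..<j + N} \<Longrightarrow> X j < X d"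
  unfolding positive_from_def
  by (metis atLeastLessThan_iff add_diff_inverse_nat greaterThanLessThan_iff
      less_diff_conv2 less_imp_le_nat not_less zero_less_diff One_nat_def Suc_leI
      nat_add_left_cancel_less)

text \<open>An index before \<open>j\<close> recurs one period later, 2 higher and inside the window
  where the walk exceeds \<open>X j\<close>. For \<open>0 < j\<close> this leaves only
  \<open>X j - 1\<close> and \<open>X j\<close> as minimum over \<open>{1..<N}\<close>.\<close>

lemma window_ge:
  assumes "positive_from j" "j < N" "0 < d" "d < N"
  shows "X j - 1 \<le> X d"
proof -
  consider "d < j" | "d = j" | "j < d" by linarith
  then show ?thesis
  proof cases
    case 1
    then have "X j < X (d + N)" using assms by (intro positive_from_less) auto
    then show ?thesis using period[of d] by simp
  next
    case 3
    then have "X j < X d" using assms by (intro positive_from_less) auto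
    then show ?thesis by simp
  qed simp
qed

text \<open>By periodicity, index \<open>d + N\<close> of the window after \<open>j\<close> corresponds to index \<open>d < j\<close> of the
  window after \<open>0\<close>, two units lower. Only \<open>j\<close> and \<open>N\<close> have no counterpart. For the upper bound \<open>N\<close>
  is sent to \<open>j\<close>; for the lower bound \<open>j\<close> is sent to an index at height exactly \<open>X j + k\<close>, which
  exists by \<open>ex_positive_height_eq\<close> unless all heights in the window are at most \<open>X j + k\<close>.\<close>

lemma count_below_upper:
  assumes "positive_from j" "j < N" "0 < j" "1 \<le> k"
  shows "count_below j (X j + k) \<le> count_below 0 (X j + k)"
  unfolding count_below_def
proof (rule card_inj_on_le)
  let ?f = "\<lambda>d. if d < N then d else if d = N then j else d - N"
  show "inj_on ?f {d \<in> {j<..<j + N}. X d \<le> X j + k}"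
    by (auto simp: inj_on_def split: if_splits)
  have "X (d - N) \<le> X j + k" if "N < d" "X d \<le> X j + k" for d
    using that period[of "d - N"] by simp
  then show "?f ` {d \<in> {j<..<j + N}. X d \<le> X j + k} \<subseteq> {d \<in> {0<..<0 + N}. X d \<le> X j + k}"
    using assms by auto
qed simp

lemma count_below_lower:
  assumes "positive_from j" "j < N" "0 < j" "1 \<le> k"
  shows "count_below 0 (X j + k - 3) \<le> count_below j (X j + k)"
proof (cases "\<exists>d\<in>{j<..<j + N}. X j + k < X d")
  case False
  then have "{d \<in> {j<..<j + N}. X d \<le> X j + k} = {j<..<j + N}" by force
  then have "count_below j (X j + k) = N - 1" by (simp add: count_below_def)
  moreover have "count_below 0 (X j + k - 3) \<le> card {0<..<0 + N}"
    unfolding count_below_def by (rule card_mono) auto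
  ultimately show ?thesis by simp
next
  case True
  then obtain d where d: "d \<in> {j<..<j + N}" "X j + k < X d" by blast
  then have "d - j \<in> {1..<N}" "k \<le> X (j + (d - j)) - X j" by auto
  then obtain e where e: "e \<in> {1..<N}" "X (j + e) - X j = k"
    using ex_positive_height_eq assms(4) by blast
  let ?f = "\<lambda>d. if d < j then d + N else if d = j then j + e else d"
  show ?thesis
    unfolding count_below_def
  proof (rule card_inj_on_le)
    \<comment> \<open>Indices moved by a period land at height at most \<open>X j + k - 1\<close>,
      so none collides with \<open>j + e\<close> at height \<open>X j + k\<close>; a loss of 2
      instead of 3 would allow a collision.\<close>
    have "X (a + N) < X (j + e)" if "X a \<le> X j + k - 3" for a
      using that e(2) period[of a] by simp
    moreover have "X a < X (j + e)" if "X a \<le> X j + k - 3" for a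
      using that e(2) by simp
    ultimately show "inj_on ?f {d \<in> {0<..<0 + N}. X d \<le> X j + k - 3}"
      by (fastforce simp: inj_on_def split: if_splits)
    show "?f ` {d \<in> {0<..<0 + N}. X d \<le> X j + k - 3} \<subseteq> {d \<in> {j<..<j + N}. X d \<le> X j + k}"
      using assms e by (auto simp: period)
  qed simp
qed

end

section \<open>Profiles\<close>

lemma sum_count_list: "finite A \<Longrightarrow> (\<Sum>l\<in>A. count_list xs l) = length (filter (\<lambda>x. x \<in> A) xs)"
proof (induction xs)
  case (Cons x xs)
  have "(\<Sum>l\<in>A. count_list (x # xs) l) = (\<Sum>l\<in>A. count_list xs l + of_bool (x = l))"
    by (intro sum.cong) auto
  then show ?case using Cons by (simp add: sum.distrib sum.delta of_bool_def)
qed auto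

lemma cumul_to_ptree:
  "cumul (to_ptree 1 b) k = length (filter (\<lambda>x. 1 \<le> x \<and> x \<le> k) (leaf_heights 1 b))"
  by (simp add: cumul_def label_count_to_ptree sum_count_list)

lemma min_label_le: "x \<in> set (leaf_heights 1 b) \<Longrightarrow> min_label (to_ptree 1 b) \<le> x"
  by (simp add: min_label_def set_ptree_to_ptree)

lemma shifted_cumul_to_ptree:
  "shifted_cumul (to_ptree 1 b) k =
    length (filter (\<lambda>x. x \<le> min_label (to_ptree 1 b) + k - 1) (leaf_heights 1 b))"
proof -
  let ?m = "min_label (to_ptree 1 b)"
  have "shifted_cumul (to_ptree 1 b) k = (\<Sum>l = ?m..?m + k - 1. label_count (to_ptree 1 b) l)"
    unfolding shifted_cumul_def
    by (rule sum.reindex_bij_witness[of _ "\<lambda>l. l - ?m + 1" "\<lambda>l. ?m + l - 1"]) auto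
  also have "\<dots> = length (filter (\<lambda>x. ?m \<le> x \<and> x \<le> ?m + k - 1) (leaf_heights 1 b))"
    by (simp add: label_count_to_ptree sum_count_list)
  also have "filter (\<lambda>x. ?m \<le> x \<and> x \<le> ?m + k - 1) (leaf_heights 1 b) =
      filter (\<lambda>x. x \<le> ?m + k - 1) (leaf_heights 1 b)"
    using min_label_le by (intro filter_cong) auto
  finally show ?thesis .
qed

lemma length_filter_eq_iff: "length (filter P xs) = length xs \<longleftrightarrow> (\<forall>x\<in>set xs. P x)"
  by (metis filter_True length_filter_less less_irrefl)

text \<open>This and the next lemma turn inequalities between profiles into inequalities between
  extremal labels.\<close>

lemma cumul_full:
  assumes "\<And>x. x \<in> set (leaf_heights 1 b) \<Longrightarrow> 0 < x"
  shows "cumul (to_ptree 1 b) k = Suc (inner_nodes b) \<longleftrightarrow> max_label (to_ptree 1 b) \<le> k"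
proof -
  have "cumul (to_ptree 1 b) k = length (leaf_heights 1 b) \<longleftrightarrow>
      (\<forall>x\<in>set (leaf_heights 1 b). 1 \<le> x \<and> x \<le> k)"
    unfolding cumul_to_ptree by (rule length_filter_eq_iff)
  also have "\<dots> \<longleftrightarrow> max_label (to_ptree 1 b) \<le> k"
    using assms by (force simp: max_label_def set_ptree_to_ptree)
  finally show ?thesis by (simp add: length_leaf_heights)
qed

lemma shifted_cumul_full:
  "shifted_cumul (to_ptree 1 b) k = Suc (inner_nodes b) \<longleftrightarrow>
    max_label (to_ptree 1 b) \<le> min_label (to_ptree 1 b) + k - 1"
proof -
  have "shifted_cumul (to_ptree 1 b) k = length (leaf_heights 1 b) \<longleftrightarrow>
      (\<forall>x\<in>set (leaf_heights 1 b). x \<le> min_label (to_ptree 1 b) + k - 1)"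
    unfolding shifted_cumul_to_ptree by (rule length_filter_eq_iff)
  also have "\<dots> \<longleftrightarrow> max_label (to_ptree 1 b) \<le> min_label (to_ptree 1 b) + k - 1"
    by (simp add: max_label_def set_ptree_to_ptree)
  finally show ?thesis by (simp add: length_leaf_heights)
qed

section \<open>Blossom trees as drifting walks\<close>

lemma drifting_walk_walk: "drifting_walk (walk b) (inner_nodes b + 2)"
  by unfold_locales (rule le_add2 walk_period walk_step)+

abbreviation positive_shift :: "blossom \<Rightarrow> nat \<Rightarrow> bool" where
  "positive_shift b \<equiv> drifting_walk.positive_from (walk b) (inner_nodes b + 2)"

lemma well_labelled_iff_positive:
  "to_ptree 1 ((rotate_root ^^ j) b) \<in> well_labelled_trees (inner_nodes b) \<longleftrightarrow> positive_shift b j"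
proof -
  interpret drifting_walk "walk b" "inner_nodes b + 2" by (rule drifting_walk_walk)
  show ?thesis
    by (auto simp: well_labelled_trees_def embedded_trees_def edges_to_ptree small_steps_to_ptree
        inner_nodes_rotate_root_pow set_ptree_to_ptree leaf_heights_rotate_root_pow
        positive_from_def simp del: upt_Suc add_2_eq_Suc')
qed

lemma length_filter_leaf_heights:
  "length (filter (\<lambda>x. x \<le> y) (leaf_heights 1 ((rotate_root ^^ i) b))) =
    drifting_walk.count_below (walk b) (inner_nodes b + 2) i (walk b i + y)"
proof -
  let ?N = "inner_nodes b + 2"
  interpret drifting_walk "walk b" ?N by (rule drifting_walk_walk)
  have "length (filter (\<lambda>x. x \<le> y) (leaf_heights 1 ((rotate_root ^^ i) b))) =
      length (filter (\<lambda>d. walk b (i + d) \<le> walk b i + y) [1..<?N])"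
    by (simp add: leaf_heights_rotate_root_pow filter_map comp_def algebra_simps del: upt_Suc)
  also have "\<dots> = card {d\<in>{1..<?N}. walk b (i + d) \<le> walk b i + y}"
    by (subst distinct_card[symmetric]) (simp_all add: conj_commute del: upt_Suc)
  also have "\<dots> = count_below i (walk b i + y)"
    unfolding count_below_def
    by (rule bij_betw_same_card[of "\<lambda>d. i + d"], rule bij_betw_byWitness[of _ "\<lambda>d. d - i"]) auto
  finally show ?thesis .
qed

lemma shifted_profile_bounds:
  fixes b :: blossom and j :: nat
  defines "w \<equiv> to_ptree 1 ((rotate_root ^^ j) b)" and "u \<equiv> to_ptree 1 b"
  assumes pos: "positive_shift b j" and j: "j < inner_nodes b + 2"
  shows "shifted_cumul u (k - 2) \<le> cumul w k \<and> cumul w k \<le> shifted_cumul u (k + 2)"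
proof (cases "1 \<le> k")
  case False
  then show ?thesis by (simp add: cumul_def shifted_cumul_def)
next
  case True
  let ?N = "inner_nodes b + 2" and ?X = "walk b"
  interpret drifting_walk ?X ?N by (rule drifting_walk_walk)
  have mono: "count_below i x \<le> count_below i y" if "x \<le> y" for i x y
    unfolding count_below_def using that by (intro card_mono) auto
  have X0: "?X 0 = 0" by (simp add: walk_def)
  have heights: "set (leaf_heights 1 b) = ?X ` {1..<?N}"
    using leaf_heights_rotate_root_pow[of 0 b] X0 by (simp del: upt_Suc)
  define m where "m = min_label u"
  have m: "m \<in> ?X ` {1..<?N}" "\<And>d. d \<in> {1..<?N} \<Longrightarrow> m \<le> ?X d"
    using heights Min_in[of "set (leaf_heights 1 b)"] min_label_le[of _ b]
    by (auto simp: m_def u_def min_label_def set_ptree_to_ptree)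
  have shifted: "shifted_cumul u l = count_below 0 (m + l - 1)" for l
    using length_filter_leaf_heights[of "m + l - 1" 0 b] X0
    by (simp add: u_def m_def shifted_cumul_to_ptree)
  have "0 < x" if "x \<in> set (leaf_heights 1 ((rotate_root ^^ j) b))" for x
    using that pos
    by (auto simp: leaf_heights_rotate_root_pow positive_from_def simp del: upt_Suc add_2_eq_Suc')
  then have "filter (\<lambda>x. 1 \<le> x \<and> x \<le> k) (leaf_heights 1 ((rotate_root ^^ j) b)) =
      filter (\<lambda>x. x \<le> k) (leaf_heights 1 ((rotate_root ^^ j) b))"
    by (intro filter_cong) force+
  then have cumul: "cumul w k = count_below j (?X j + k)"
    using length_filter_leaf_heights[of k j b] by (simp add: w_def cumul_to_ptree)
  show ?thesis
  proof (cases "j = 0")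
    \<comment> \<open>Nothing is shifted: the root label forces \<open>m = 1\<close>, both profiles
      agree, and monotonicity suffices.\<close>
    case True
    have "1 \<in> set (leaf_heights 1 b)"
      using ptree.set_sel(1)[of u] by (simp add: u_def set_ptree_to_ptree)
    then have "m \<le> 1" by (simp add: m_def u_def min_label_le)
    moreover have "0 < m" using m(1) pos True X0
      by (auto simp: positive_from_def simp del: add_2_eq_Suc')
    ultimately have "m = 1" by simp
    then show ?thesis
      unfolding shifted cumul using True X0 by (simp add: mono del: add_2_eq_Suc')
  next
    case False
    \<comment> \<open>As \<open>m\<close> is \<open>?X j\<close> or \<open>?X j - 1\<close>,
      replacing \<open>?X j\<close> by \<open>m\<close> costs at most 1 in the upper bound and
      nothing in the lower one.\<close>
    have "m \<le> ?X j" using m(2)[of j] False j by simp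
    moreover have "?X j - 1 \<le> m" using m(1) window_ge[OF pos j] by fastforce
    ultimately have "count_below 0 (m + (k - 2) - 1) \<le> count_below 0 (?X j + k - 3)"
      "count_below 0 (?X j + k) \<le> count_below 0 (m + (k + 2) - 1)"
      by (auto intro!: mono simp del: add_2_eq_Suc')
    then show ?thesis
      using count_below_upper[OF pos j _ True] count_below_lower[OF pos j _ True] False
      unfolding shifted cumul by simp
  qed
qed

lemma shifted_range_bound:
  fixes b :: blossom and j :: nat
  defines "w \<equiv> to_ptree 1 ((rotate_root ^^ j) b)" and "u \<equiv> to_ptree 1 b"
  assumes pos: "positive_shift b j" and j: "j < inner_nodes b + 2"
  shows "\<bar>max_label w - (max_label u - min_label u)\<bar> \<le> 3"
proof -
  have "0 < x" if "x \<in> set (leaf_heights 1 ((rotate_root ^^ j) b))" for x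
    using that pos well_labelled_iff_positive[of j b]
    by (auto simp: well_labelled_trees_def set_ptree_to_ptree)
  then have w_full: "cumul w k = Suc (inner_nodes b) \<longleftrightarrow> max_label w \<le> k" for k
    using cumul_full[of "(rotate_root ^^ j) b" k] by (simp add: w_def inner_nodes_rotate_root_pow)
  have u_full: "shifted_cumul u k = Suc (inner_nodes b) \<longleftrightarrow> max_label u \<le> min_label u + k - 1" for k
    using shifted_cumul_full[of b k] by (simp add: u_def)
  have w_le: "cumul w k \<le> Suc (inner_nodes b)" for k
    unfolding w_def cumul_to_ptree
    by (metis inner_nodes_rotate_root_pow length_filter_le length_leaf_heights)
  have u_le: "shifted_cumul u k \<le> Suc (inner_nodes b)" for k
    unfolding u_def shifted_cumul_to_ptree by (metis length_filter_le length_leaf_heights)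
  have bounds: "shifted_cumul u (k - 2) \<le> cumul w k \<and> cumul w k \<le> shifted_cumul u (k + 2)" for k
    unfolding w_def u_def by (rule shifted_profile_bounds[OF pos j])
  have "shifted_cumul u (max_label w + 2) = Suc (inner_nodes b)"
    using bounds[of "max_label w"] w_full[of "max_label w"] u_le[of "max_label w + 2"] by simp
  then have "max_label u \<le> min_label u + max_label w + 1" by (simp add: u_full)
  \<comment> \<open>The 3 is 2 + 1: the shifted profile is full from index
    \<open>max_label u - min_label u + 1\<close> on, and that of \<open>w\<close> lags by at most
    2.\<close>
  moreover have "cumul w (max_label u - min_label u + 3) = Suc (inner_nodes b)"
  proof (rule antisym[OF w_le])
    have "shifted_cumul u (max_label u - min_label u + 3 - 2) = Suc (inner_nodes b)"
      by (subst u_full) simp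
    then show "Suc (inner_nodes b) \<le> cumul w (max_label u - min_label u + 3)"
      using bounds by metis
  qed
  then have "max_label w \<le> max_label u - min_label u + 3" by (simp add: w_full)
  ultimately show ?thesis by linarith
qed

section \<open>The coupling\<close>

text \<open>Each point of \<open>B\<close> receives mass \<open>c / card A\<close>, and
  \<open>card A = c * card B\<close>.\<close>

lemma map_pmf_of_set_const_fibres:
  assumes "finite A" "finite B" "B \<noteq> {}" "f ` A \<subseteq> B" "0 < c"
    and fibre: "\<And>y. y \<in> B \<Longrightarrow> card {x\<in>A. f x = y} = c"
  shows "map_pmf f (pmf_of_set A) = pmf_of_set B"
proof (rule pmf_eqI)
  fix y
  have card: "card A = c * card B"
  proof -
    have "card A = (\<Sum>y\<in>B. card {x\<in>A. f x = y})"
      using sum.group[OF assms(1,2,4), of "\<lambda>_. 1::nat"] by simp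
    then show ?thesis using fibre by simp
  qed
  have "A \<noteq> {}" using card assms by auto
  then have "pmf (map_pmf f (pmf_of_set A)) y = card {x\<in>A. f x = y} / card A"
    using assms(1) by (simp add: pmf_map measure_pmf_of_set vimage_def Int_def)
  also have "\<dots> = pmf (pmf_of_set B) y"
  proof (cases "y \<in> B")
    case True
    then show ?thesis using card fibre assms by simp
  next
    case False
    then have "{x\<in>A. f x = y} = {}" using assms(4) by auto
    then show ?thesis using False assms by simp
  qed
  finally show "pmf (map_pmf f (pmf_of_set A)) y = pmf (pmf_of_set B) y" .
qed

text \<open>The common probability space of the coupling: forgetting \<open>j\<close> is 2-to-1 onto
  the embedded trees, and carrying out the shift is \<open>(n + 2)\<close>-to-1 onto the well
  labelled ones.\<close>

definition positive_shifts :: "nat \<Rightarrow> (blossom \<times> nat) set" where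
  "positive_shifts n = {(b, j). inner_nodes b = n \<and> j < n + 2 \<and> positive_shift b j}"

lemma finite_inner_nodes: "finite {b. inner_nodes b = n}"
  using bij_betw_finite[OF bij_betw_to_ptree] finite_embedded_trees by blast

lemma finite_positive_shifts: "finite (positive_shifts n)"
  by (rule finite_subset[of _ "{b. inner_nodes b = n} \<times> {..<n + 2}"])
    (auto simp: positive_shifts_def finite_inner_nodes)

lemma unshifted_uniform:
  "map_pmf (\<lambda>(b, j). to_ptree 1 b) (pmf_of_set (positive_shifts n)) =
    pmf_of_set (embedded_trees n)"
proof (rule map_pmf_of_set_const_fibres[where c = 2])
  show "(\<lambda>(b, j). to_ptree 1 b) ` positive_shifts n \<subseteq> embedded_trees n"
    using bij_betwE[OF bij_betw_to_ptree] by (auto simp: positive_shifts_def)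
  fix t assume "t \<in> embedded_trees n"
  then obtain b where b: "inner_nodes b = n" "t = to_ptree 1 b"
    using bij_betw_imp_surj_on[OF bij_betw_to_ptree, of n] by auto
  interpret drifting_walk "walk b" "n + 2" using drifting_walk_walk[of b] b by simp
  have "{x \<in> positive_shifts n. (\<lambda>(b, j). to_ptree 1 b) x = t} =
      Pair b ` {j. j < n + 2 \<and> positive_from j}"
    using b by (auto simp: positive_shifts_def dest: to_ptree_inj)
  then show "card {x \<in> positive_shifts n. (\<lambda>(b, j). to_ptree 1 b) x = t} = 2"
    using card_positive_from by (simp add: card_image inj_on_def del: add_2_eq_Suc')
qed (simp_all add: finite_positive_shifts finite_embedded_trees embedded_trees_nonempty)

text \<open>Each power of \<open>rotate_root\<close> permutes the finite set of blossom trees with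
  \<open>n\<close> inner nodes, so every \<open>j < n + 2\<close> contributes exactly one preimage;
  it is a positive shift because the target is well labelled.\<close>

lemma shifted_uniform:
  "map_pmf (\<lambda>(b, j). to_ptree 1 ((rotate_root ^^ j) b)) (pmf_of_set (positive_shifts n)) =
    pmf_of_set (well_labelled_trees n)"
proof (rule map_pmf_of_set_const_fibres[where c = "n + 2"])
  let ?f = "\<lambda>(b, j). to_ptree 1 ((rotate_root ^^ j) b)"
  show "?f ` positive_shifts n \<subseteq> well_labelled_trees n"
    using well_labelled_iff_positive by (auto simp: positive_shifts_def)
  fix t assume t: "t \<in> well_labelled_trees n"
  then obtain c where c: "inner_nodes c = n" "t = to_ptree 1 c"
    using bij_betw_imp_surj_on[OF bij_betw_to_ptree, of n] well_labelled_subset_embedded[of n]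
    by auto
  have inj: "inj (rotate_root ^^ j)" for j
    using inj_rotate_root by (rule inj_fn)
  have "(rotate_root ^^ j) ` {b. inner_nodes b = n} = {b. inner_nodes b = n}" for j
    by (rule endo_inj_surj[OF finite_inner_nodes])
      (auto simp: inner_nodes_rotate_root_pow intro: inj_on_subset[OF inj])
  then have surj: "\<exists>b. inner_nodes b = n \<and> (rotate_root ^^ j) b = c" for j
    using c(1) by (metis (mono_tags, lifting) imageE mem_Collect_eq)
  have pos: "positive_shift b j" if "inner_nodes b = n" "(rotate_root ^^ j) b = c" for b j
    using that t c(2) well_labelled_iff_positive[of j b] by simp
  have fibre: "{x \<in> positive_shifts n. ?f x = t} =
      {(b, j). inner_nodes b = n \<and> j < n + 2 \<and> (rotate_root ^^ j) b = c}"
    using pos c by (auto simp: positive_shifts_def dest: to_ptree_inj simp del: add_2_eq_Suc')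
  have "bij_betw snd {x \<in> positive_shifts n. ?f x = t} {..<n + 2}"
    unfolding fibre bij_betw_def
  proof
    show "inj_on snd {(b, j). inner_nodes b = n \<and> j < n + 2 \<and> (rotate_root ^^ j) b = c}"
      using inj by (auto simp: inj_on_def dest: injD)
    show "snd ` {(b, j). inner_nodes b = n \<and> j < n + 2 \<and> (rotate_root ^^ j) b = c} = {..<n + 2}"
      using surj by (force simp: image_iff)
  qed
  from bij_betw_same_card[OF this] show "card {x \<in> positive_shifts n. ?f x = t} = n + 2"
    by (simp only: card_lessThan)
qed (simp_all add: finite_positive_shifts finite_well_labelled_trees well_labelled_trees_nonempty)

theorem theorem3:
  fixes n :: nat
  assumes "n \<ge> 1"
  shows "\<exists>p :: (int ptree \<times> int ptree) pmf.
    set_pmf p \<subseteq> well_labelled_trees n \<times> embedded_trees n \<and>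
    map_pmf fst p = pmf_of_set (well_labelled_trees n) \<and>
    map_pmf snd p = pmf_of_set (embedded_trees n) \<and>
    (AE (w, u) in measure_pmf p.
      (\<forall>k::int. shifted_cumul u (k - 2) \<le> cumul w k \<and> cumul w k \<le> shifted_cumul u (k + 2)) \<and>
      \<bar>max_label w - (max_label u - min_label u)\<bar> \<le> 3)"
proof -
  let ?G = "positive_shifts n"
  define p where "p = map_pmf (\<lambda>(b, j). (to_ptree 1 ((rotate_root ^^ j) b), to_ptree 1 b))
    (pmf_of_set ?G)"
  have fst: "map_pmf fst p = pmf_of_set (well_labelled_trees n)"
    using shifted_uniform[of n] by (simp add: p_def pmf.map_comp comp_def case_prod_unfold)
  have snd: "map_pmf snd p = pmf_of_set (embedded_trees n)"
    using unshifted_uniform[of n] by (simp add: p_def pmf.map_comp comp_def case_prod_unfold)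
  have "set_pmf (map_pmf fst p) = well_labelled_trees n" "set_pmf (map_pmf snd p) = embedded_trees n"
    unfolding fst snd
    by (simp_all add: finite_well_labelled_trees well_labelled_trees_nonempty
        finite_embedded_trees embedded_trees_nonempty)
  then have "set_pmf p \<subseteq> well_labelled_trees n \<times> embedded_trees n"
    using subset_fst_snd[of "set_pmf p"] by simp
  \<comment> \<open>Nonemptiness identifies the support of \<open>pmf_of_set ?G\<close> with
    \<open>?G\<close>, so the bounds need checking only for positive shifts.\<close>
  moreover have "?G \<noteq> {}"
  proof -
    obtain b where b: "inner_nodes b = n"
      using bij_betw_imp_surj_on[OF bij_betw_to_ptree, of n] embedded_trees_nonempty[of n] by blast
    interpret drifting_walk "walk b" "n + 2" using drifting_walk_walk[of b] b by simp
    have "{j. j < n + 2 \<and> positive_from j} \<noteq> {}"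
      using card_positive_from by (metis card.empty zero_neq_numeral)
    then show ?thesis using b by (auto simp: positive_shifts_def)
  qed
  then have "AE (w, u) in measure_pmf p.
      (\<forall>k::int. shifted_cumul u (k - 2) \<le> cumul w k \<and> cumul w k \<le> shifted_cumul u (k + 2)) \<and>
      \<bar>max_label w - (max_label u - min_label u)\<bar> \<le> 3"
    using shifted_profile_bounds shifted_range_bound finite_positive_shifts[of n]
    by (auto simp: AE_measure_pmf_iff p_def positive_shifts_def)
  ultimately show ?thesis using fst snd by blast
qed

end
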